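(* For all integers $n\geq 0$ and $k\geq 0$, $$F_{n+1,2}(k)=2F_{n,2}(k)+(k+1)\sum_{i=0}^{n}\binom{n}{i}F_{n-i,2}(k+1).$$
   Context: For an integer $n\ge 0$ let $X_n=\{x_1,\ldots,x_n\}$ be an $n$-element set ($X_0=\emptyset$). For each integer $k\ge 0$ fix an arbitrary choice of $k$ real numbers ("spikes") $0<a_1<a_2<\cdots<a_k<1$, and set $a_0=0$, $a_{k+1}=1$. Consider fuzzy subsets of $X_n$ avoiding the spikes, i.e. maps $\mu:X_n\to[0,1]\setminus\{a_1,\ldots,a_k\}$. Two such fuzzy subsets $\mu,\nu$ are called equivalent ($\mu\sim\nu$) if for all $i=0,1,\ldots,k$ and all $x,y\in X_n$ (with $x=y$ allowed): (i) $\mu(x)=a_{k+1}$ if and only if $\nu(x)=a_{k+1}$; (ii) $a_{i+1}>\mu(x)\geq\mu(y)>a_i$ if and only if $a_{i+1}>\nu(x)\geq\nu(y)>a_i$; (iii) $\mu(x)=a_0$ if and only if $\nu(x)=a_0$. $F_{n,2}(k)$ denotes the number of equivalence classes of $\sim$ on the set of all maps $\mu:X_n\to[0,1]\setminus\{a_1,\ldots,a_k\}$ (both boundary values $0$ and $1$ allowed). For $n=0$ there is exactly one (empty) map, so $F_{0,2}(k)=1$. *)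

theory Defs
  imports Complex_Main "HOL-Library.FuncSet"
begin

text \<open>
  A choice of \<open>k\<close> spikes \<open>0 < a 1 < \<dots> < a k < 1\<close>, with the conventions \<open>a 0 = 0\<close> and
  \<open>a (k + 1) = 1\<close> included. Values of \<open>a\<close> beyond index \<open>k + 1\<close> are irrelevant.
\<close>
definition spikes :: "nat \<Rightarrow> (nat \<Rightarrow> real) \<Rightarrow> bool" where
  "spikes k a \<longleftrightarrow> a 0 = 0 \<and> a (k + 1) = 1 \<and> (\<forall>i\<le>k. a i < a (i + 1))"

text \<open>
  Maps on \<open>X\<close> are represented by functions that are \<open>undefined\<close> outside \<open>X\<close> (\<open>\<rightarrow>\<^sub>E\<close>), so that
  distinct functions are distinct maps; for \<open>X = {}\<close> there is exactly one.
\<close>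
definition fuzzy_subsets :: "'a set \<Rightarrow> nat \<Rightarrow> (nat \<Rightarrow> real) \<Rightarrow> ('a \<Rightarrow> real) set" where
  "fuzzy_subsets X k a = X \<rightarrow>\<^sub>E ({0..1} - a ` {1..k})"

definition fuzzy_equiv ::
  "'a set \<Rightarrow> nat \<Rightarrow> (nat \<Rightarrow> real) \<Rightarrow> ('a \<Rightarrow> real) \<Rightarrow> ('a \<Rightarrow> real) \<Rightarrow> bool" where
  "fuzzy_equiv X k a \<mu> \<nu> \<longleftrightarrow>
     (\<forall>i\<in>{0..k}. \<forall>x\<in>X. \<forall>y\<in>X.
        (\<mu> x = a (k + 1) \<longleftrightarrow> \<nu> x = a (k + 1)) \<and>
        (a (i + 1) > \<mu> x \<and> \<mu> x \<ge> \<mu> y \<and> \<mu> y > a i \<longleftrightarrow>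
         a (i + 1) > \<nu> x \<and> \<nu> x \<ge> \<nu> y \<and> \<nu> y > a i) \<and>
        (\<mu> x = a 0 \<longleftrightarrow> \<nu> x = a 0))"

definition fuzzy_equiv_rel ::
  "'a set \<Rightarrow> nat \<Rightarrow> (nat \<Rightarrow> real) \<Rightarrow> (('a \<Rightarrow> real) \<times> ('a \<Rightarrow> real)) set" where
  "fuzzy_equiv_rel X k a =
     {(\<mu>, \<nu>). \<mu> \<in> fuzzy_subsets X k a \<and> \<nu> \<in> fuzzy_subsets X k a \<and> fuzzy_equiv X k a \<mu> \<nu>}"

lemma equiv_fuzzy_equiv_rel: "equiv (fuzzy_subsets X k a) (fuzzy_equiv_rel X k a)"
  by (rule equivI)
     (auto simp: fuzzy_equiv_rel_def fuzzy_equiv_def refl_on_def sym_def trans_def)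

text \<open>
  \<open>F2 X a n k\<close> is \<open>F\<^bsub>n,2\<^esub>(k)\<close> for a family \<open>X\<close> of ground sets (\<open>X n\<close> having \<open>n\<close> elements) and a
  family \<open>a\<close> of spike choices (\<open>a k\<close> consisting of \<open>k\<close> spikes).
\<close>
definition F2 :: "(nat \<Rightarrow> 'a set) \<Rightarrow> (nat \<Rightarrow> nat \<Rightarrow> real) \<Rightarrow> nat \<Rightarrow> nat \<Rightarrow> nat" where
  "F2 X a n k = card (fuzzy_subsets (X n) k (a k) // fuzzy_equiv_rel (X n) k (a k))"

end

theory Submission
  imports Defs
begin

text \<open>
  A class is determined by how the values of a map compare with each other and with the spikes;
  this order type is meaningful across different choices of spikes, and a strictly increasing
  piecewise linear map carrying one choice to another shows that all choices realise the same
  order types. Now single out a point \<open>z\<close> of an \<open>(n + 1)\<close>-element set. If \<open>\<mu> z\<close> is \<open>0\<close> or \<open>1\<close>,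
  then \<open>z\<close> can be dropped. Otherwise \<open>\<mu> z\<close> lies in one of the \<open>k + 1\<close> gaps between spikes; taking
  \<open>\<mu> z\<close> as an additional spike and removing the \<open>i\<close> other points at which \<open>\<mu>\<close> takes that value
  leaves an arbitrary map on \<open>n - i\<close> points avoiding \<open>k + 1\<close> spikes.
\<close>

section \<open>Counting tools\<close>

text \<open>On \<open>A\<close> the functions \<open>f\<close> and \<open>g \<circ> h\<close> have
  the same fibres, so \<open>f p \<mapsto> g (h p)\<close> is a well-defined bijection of the
  images. \<open>h\<close> has to reach \<open>B\<close> only up to \<open>g\<close>-values, which
  suits reductions that keep just the order type.\<close>

lemma card_image_eq_card_image:
  assumes "\<And>p q. p \<in> A \<Longrightarrow> q \<in> A \<Longrightarrow> f p = f q \<longleftrightarrow> g (h p) = g (h q)"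
    and "\<And>p. p \<in> A \<Longrightarrow> h p \<in> B"
    and "\<And>b. b \<in> B \<Longrightarrow> \<exists>p\<in>A. g (h p) = g b"
  shows "card (f ` A) = card (g ` B)"
proof -
  have B: "g ` B = (\<lambda>p. g (h p)) ` A"
    using assms(2,3) by (force simp: image_iff)
  have inv: "inv_into A f (f p) \<in> A \<and> f (inv_into A f (f p)) = f p" if "p \<in> A" for p
    using that by (simp add: inv_into_into f_inv_into_f)
  have *: "g (h (inv_into A f (f p))) = g (h p)" if "p \<in> A" for p
    using inv[OF that] assms(1) that by metis
  \<comment> \<open>\<open>inv_into A f\<close> picks a representative of each fibre; by
    \<open>*\<close> the choice does not affect the value.\<close>
  have "bij_betw (\<lambda>y. g (h (inv_into A f y))) (f ` A) (g ` B)"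
    unfolding bij_betw_def inj_on_def B image_image
    using * assms(1) by (auto simp: image_iff)
  then show ?thesis
    by (rule bij_betw_same_card)
qed

lemma sum_Pow_card:
  fixes f :: "nat \<Rightarrow> nat"
  assumes "finite X"
  shows "(\<Sum>S\<in>Pow X. f (card S)) = (\<Sum>i=0..card X. (card X choose i) * f i)"
proof -
  have "(\<Sum>S\<in>Pow X. f (card S)) = (\<Sum>i=0..card X. \<Sum>S\<in>{S \<in> Pow X. card S = i}. f (card S))"
    using assms by (intro sum.group[symmetric]) (auto intro: card_mono)
  also have "\<dots> = (\<Sum>i=0..card X. card {S \<in> Pow X. card S = i} * f i)"
    by (intro sum.cong refl) simp
  finally show ?thesis
    using n_subsets[OF assms] by simp
qed


section \<open>Spikes\<close>

lemma spikes_less: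
  assumes "spikes k a" "i < j" "j \<le> k + 1"
  shows "a i < a j"
  using assms(2,3)
proof (induction j)
  case (Suc j)
  have "a j < a (Suc j)"
    using assms(1) Suc.prems by (simp add: spikes_def)
  then show ?case
    using Suc by (cases "i = j") auto
qed simp

lemma spikes_le_iff:
  assumes "spikes k a" "i \<le> k + 1" "j \<le> k + 1"
  shows "a i \<le> a j \<longleftrightarrow> i \<le> j"
  using spikes_less[OF assms(1), of i j] spikes_less[OF assms(1), of j i] assms(2,3)
  by (cases i j rule: linorder_cases) auto

text \<open>Within a gap, the index \<open>j\<close> alone settles every comparison with the spikes,
  since these are sorted.\<close>

lemma gap_compare:
  assumes "spikes k a" "j \<le> k" "a j < v" "v < a (j + 1)" "i \<le> k + 1"
  shows "a i \<le> v \<longleftrightarrow> i \<le> j" "v \<le> a i \<longleftrightarrow> j < i"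
  using spikes_le_iff[OF assms(1), of i j] spikes_le_iff[OF assms(1), of "j + 1" i] assms
  by auto

lemma gap_cases:
  assumes a: "spikes k a" and v: "v \<in> {0..1} - a ` {1..k}"
  obtains "v = a 0" | "v = a (k + 1)" | j where "j \<le> k" "a j < v" "v < a (j + 1)"
proof -
  have "v = a 0 \<or> v = a (k + 1) \<or> (\<exists>j\<le>k. a j < v \<and> v < a (j + 1))"
  proof (cases "v = a 0")
    case False
    \<comment> \<open>The gap starts at the last entry up to \<open>k\<close> below
      \<open>v\<close>. The case \<open>j = k\<close> is separate at the end, because
      \<open>v\<close> may equal the upper bound \<open>a (k + 1)\<close>, which is not a
      spike.\<close>
    define j where "j = (GREATEST j. j \<le> k \<and> a j < v)"
    have 0: "0 \<le> k \<and> a 0 < v"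
      using False v a by (auto simp: spikes_def)
    have j: "j \<le> k \<and> a j < v"
      unfolding j_def by (rule GreatestI_nat[of "\<lambda>j. j \<le> k \<and> a j < v" 0 k]) (use 0 in auto)
    have "\<not> (j + 1 \<le> k \<and> a (j + 1) < v)"
      using Greatest_le_nat[of "\<lambda>j. j \<le> k \<and> a j < v" "j + 1" k] by (auto simp: j_def)
    moreover have "v \<le> a (k + 1)" "j + 1 \<le> k \<longrightarrow> v \<noteq> a (j + 1)"
      using v a by (auto simp: spikes_def)
    ultimately show ?thesis
      using j by (cases "j = k") force+
  qed simp
  then show thesis
    using that by blast
qed

text \<open>Piecewise linear interpolation, one linear piece per induction step. It is stated for
  arbitrary increasing sequences because an initial segment of a spike choice no longer ends at
  \<open>1\<close>.\<close>

lemma spikes_strict_mono_transport: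
  assumes "\<And>i. i < m \<Longrightarrow> a i < a (Suc i)" and "\<And>i. i < m \<Longrightarrow> b i < b (Suc i)"
  shows "\<exists>\<phi>::real \<Rightarrow> real. strict_mono_on {a 0..a m} \<phi> \<and> (\<forall>i\<le>m. \<phi> (a i) = b i)"
  using assms
proof (induction m)
  case 0
  show ?case
    by (rule exI[of _ "\<lambda>_. b 0"]) (auto simp: strict_mono_on_def)
next
  case (Suc m)
  then obtain \<phi> where mono: "strict_mono_on {a 0..a m} \<phi>" and \<phi>: "\<And>i. i \<le> m \<Longrightarrow> \<phi> (a i) = b i"
    by (metis less_Suc_eq)
  have le: "a i \<le> a m" if "i \<le> m" for i
    using that
  proof (induction rule: inc_induct)
    case (step i)
    then show ?case using Suc.prems(1)[of i] by simp
  qed simp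
  define c where "c = (b (Suc m) - b m) / (a (Suc m) - a m)"
  have am: "a m < a (Suc m)" and c: "c > 0"
    using Suc.prems by (simp_all add: c_def)
  define \<psi> where "\<psi> v = (if v \<le> a m then \<phi> v else b m + c * (v - a m))" for v
  \<comment> \<open>The old pieces stay at or below \<open>b m\<close> and the new one lies above
    it; this gives monotonicity across the joint.\<close>
  have up: "\<psi> v \<le> b m" if "a 0 \<le> v" "v \<le> a m" for v
    using strict_mono_onD[OF mono, of v "a m"] that \<phi>[of m] le[of 0]
    by (cases "v = a m") (auto simp: \<psi>_def)
  have "strict_mono_on {a 0..a (Suc m)} \<psi>"
  proof (rule strict_mono_onI)
    fix u v assume uv: "u \<in> {a 0..a (Suc m)}" "v \<in> {a 0..a (Suc m)}" "u < v"
    consider "v \<le> a m" | "u \<le> a m" "a m < v" | "a m < u"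
      by linarith
    then show "\<psi> u < \<psi> v"
    proof cases
      case 1
      then show ?thesis
        using strict_mono_onD[OF mono, of u v] uv by (simp add: \<psi>_def)
    next
      case 2
      then have "b m < \<psi> v"
        using c by (simp add: \<psi>_def)
      then show ?thesis
        using up[of u] 2 uv by simp
    next
      case 3
      then show ?thesis
        using c uv by (simp add: \<psi>_def)
    qed
  qed
  moreover have "\<psi> (a i) = b i" if "i \<le> Suc m" for i
    using that \<phi>[of i] le[of i] am by (cases "i = Suc m") (auto simp: \<psi>_def c_def)
  ultimately show ?case
    by blast
qed


section \<open>Order types\<close>

text \<open>The spikes vary together with the map, so that a value can later be turned into a spike.
  Nothing is demanded of \<open>\<mu>\<close> outside \<open>X\<close>, so the same function can be
  read on a smaller set.\<close>

definition spiked_maps :: "'a set \<Rightarrow> nat \<Rightarrow> ((nat \<Rightarrow> real) \<times> ('a \<Rightarrow> real)) set" where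
  "spiked_maps X k = {(a, \<mu>). spikes k a \<and> (\<forall>x\<in>X. \<mu> x \<in> {0..1} - a ` {1..k})}"

text \<open>Both directions of \<open>\<le>\<close> against the spikes are recorded, so equality and
  strictness can be recovered. Comparisons among spikes are left out, being the same for every
  choice.\<close>

fun order_type :: "'a set \<Rightarrow> nat \<Rightarrow> (nat \<Rightarrow> real) \<times> ('a \<Rightarrow> real) \<Rightarrow>
    (nat \<times> 'a) set \<times> (nat \<times> 'a) set \<times> ('a \<times> 'a) set" where
  "order_type X k (a, \<mu>) =
     ({(i, x). i \<le> k + 1 \<and> x \<in> X \<and> a i \<le> \<mu> x}, {(i, x). i \<le> k + 1 \<and> x \<in> X \<and> \<mu> x \<le> a i},
      {(x, y). x \<in> X \<and> y \<in> X \<and> \<mu> x \<le> \<mu> y})"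

lemma order_type_eq_iff:
  "order_type X k (a, \<mu>) = order_type X k (b, \<nu>) \<longleftrightarrow>
     (\<forall>x\<in>X. \<forall>i\<le>k + 1. (a i \<le> \<mu> x \<longleftrightarrow> b i \<le> \<nu> x) \<and> (\<mu> x \<le> a i \<longleftrightarrow> \<nu> x \<le> b i)) \<and>
     (\<forall>x\<in>X. \<forall>y\<in>X. \<mu> x \<le> \<mu> y \<longleftrightarrow> \<nu> x \<le> \<nu> y)"
  by (simp add: set_eq_iff) blast

lemma finite_order_type_image:
  assumes "finite X"
  shows "finite (order_type X k ` A)"
proof (rule finite_subset)
  show "order_type X k ` A \<subseteq> Pow ({..k + 1} \<times> X) \<times> Pow ({..k + 1} \<times> X) \<times> Pow (X \<times> X)"
    by auto
qed (use assms in simp)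

declare order_type.simps [simp del]

section \<open>From equivalence classes to order types\<close>

text \<open>Composing \<open>\<nu>\<close> with an increasing \<open>\<phi>\<close> that sends each
  \<open>b i\<close> to \<open>a i\<close> preserves every comparison, including those that keep
  values in the unit interval and off the spikes.\<close>

lemma order_type_transport:
  assumes "(b, \<nu>) \<in> spiked_maps X k" and a: "spikes k a"
  shows "\<exists>\<mu> \<in> fuzzy_subsets X k a. order_type X k (a, \<mu>) = order_type X k (b, \<nu>)"
proof -
  have b: "spikes k b" and \<nu>: "\<And>x. x \<in> X \<Longrightarrow> \<nu> x \<in> {0..1} - b ` {1..k}"
    using assms by (auto simp: spiked_maps_def)
  obtain \<phi> where mono: "strict_mono_on {b 0..b (k + 1)} \<phi>" and \<phi>: "\<forall>i\<le>k + 1. \<phi> (b i) = a i"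
    using spikes_strict_mono_transport[of "k + 1" b a] a b by (auto simp: spikes_def less_Suc_eq_le)
  have le: "\<phi> u \<le> \<phi> v \<longleftrightarrow> u \<le> v" if "u \<in> {0..1}" "v \<in> {0..1}" for u v
    using strict_mono_onD[OF mono, of u v] strict_mono_onD[OF mono, of v u] that b
    by (cases u v rule: linorder_cases) (auto simp: spikes_def)
  have b01: "b i \<in> {0..1}" if "i \<le> k + 1" for i
    using spikes_le_iff[OF b, of 0 i] spikes_le_iff[OF b, of i "k + 1"] b that
    by (auto simp: spikes_def)
  have cmp: "a i \<le> \<phi> (\<nu> x) \<longleftrightarrow> b i \<le> \<nu> x" "\<phi> (\<nu> x) \<le> a i \<longleftrightarrow> \<nu> x \<le> b i"
    if "i \<le> k + 1" "x \<in> X" for i x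
    using le[of "b i" "\<nu> x"] le[of "\<nu> x" "b i"] b01[of i] \<nu>[of x] \<phi> that by auto
  define \<mu> where "\<mu> = restrict (\<lambda>x. \<phi> (\<nu> x)) X"
  have "\<phi> (\<nu> x) \<in> {0..1} - a ` {1..k}" if x: "x \<in> X" for x
  proof -
    have "0 \<le> \<phi> (\<nu> x)" "\<phi> (\<nu> x) \<le> 1"
      using cmp(1)[of 0 x] cmp(2)[of "k + 1" x] \<nu>[OF x] x a b by (auto simp: spikes_def)
    moreover have "\<phi> (\<nu> x) \<notin> a ` {1..k}"
    proof
      assume "\<phi> (\<nu> x) \<in> a ` {1..k}"
      then obtain i where i: "i \<in> {1..k}" "\<phi> (\<nu> x) = a i"
        by blast
      then have "\<nu> x = b i"
        using cmp[of i x] x by auto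
      then show False
        using \<nu>[OF x] i(1) by blast
    qed
    ultimately show ?thesis
      by simp
  qed
  then have "\<mu> \<in> fuzzy_subsets X k a"
    by (auto simp: fuzzy_subsets_def \<mu>_def)
  moreover have "order_type X k (a, \<mu>) = order_type X k (b, \<nu>)"
    unfolding order_type_eq_iff using cmp le \<nu> by (simp add: \<mu>_def)
  ultimately show ?thesis
    by blast
qed

text \<open>The equivalence compares two values only within one gap. This suffices: every value is
  \<open>0\<close>, \<open>1\<close> or in a gap, and values in different places are ordered by
  their places.\<close>

lemma fuzzy_equiv_iff_order_type:
  assumes a: "spikes k a" and "\<mu> \<in> fuzzy_subsets X k a" "\<nu> \<in> fuzzy_subsets X k a"
  shows "fuzzy_equiv X k a \<mu> \<nu> \<longleftrightarrow> order_type X k (a, \<mu>) = order_type X k (a, \<nu>)"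
proof
  assume "order_type X k (a, \<mu>) = order_type X k (a, \<nu>)"
  then have *: "\<And>x i. x \<in> X \<Longrightarrow> i \<le> k + 1 \<Longrightarrow> (a i \<le> \<mu> x \<longleftrightarrow> a i \<le> \<nu> x) \<and> (\<mu> x \<le> a i \<longleftrightarrow> \<nu> x \<le> a i)"
    and le: "\<And>x y. x \<in> X \<Longrightarrow> y \<in> X \<Longrightarrow> \<mu> x \<le> \<mu> y \<longleftrightarrow> \<nu> x \<le> \<nu> y"
    unfolding order_type_eq_iff by blast+
  show "fuzzy_equiv X k a \<mu> \<nu>"
    unfolding fuzzy_equiv_def
  proof (intro ballI)
    fix i x y assume "i \<in> {0..k}" "x \<in> X" "y \<in> X"
    moreover have "\<mu> w = a l \<longleftrightarrow> \<nu> w = a l" "\<mu> w < a l \<longleftrightarrow> \<nu> w < a l" "a l < \<mu> w \<longleftrightarrow> a l < \<nu> w"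
      if "w \<in> X" "l \<le> k + 1" for w l
      using *[OF that] by linarith+
    ultimately show "(\<mu> x = a (k + 1) \<longleftrightarrow> \<nu> x = a (k + 1)) \<and>
        (a (i + 1) > \<mu> x \<and> \<mu> x \<ge> \<mu> y \<and> \<mu> y > a i \<longleftrightarrow>
         a (i + 1) > \<nu> x \<and> \<nu> x \<ge> \<nu> y \<and> \<nu> y > a i) \<and> (\<mu> x = a 0 \<longleftrightarrow> \<nu> x = a 0)"
      using le[of y x] by simp
  qed
next
  assume "fuzzy_equiv X k a \<mu> \<nu>"
  note equiv = bspec[OF bspec[OF bspec[OF this[unfolded fuzzy_equiv_def]]]]
  \<comment> \<open>The two end conditions do not mention the gap index, so its instance
    \<open>0\<close> yields them.\<close>
  have one: "\<And>x. x \<in> X \<Longrightarrow> \<mu> x = a (k + 1) \<longleftrightarrow> \<nu> x = a (k + 1)"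
    and zero: "\<And>x. x \<in> X \<Longrightarrow> \<mu> x = a 0 \<longleftrightarrow> \<nu> x = a 0"
    and gap: "\<And>i x y. i \<le> k \<Longrightarrow> x \<in> X \<Longrightarrow> y \<in> X \<Longrightarrow>
       a (i + 1) > \<mu> x \<and> \<mu> x \<ge> \<mu> y \<and> \<mu> y > a i \<longleftrightarrow> a (i + 1) > \<nu> x \<and> \<nu> x \<ge> \<nu> y \<and> \<nu> y > a i"
    using equiv[of 0] equiv by simp_all
  have \<mu>: "\<mu> x \<in> {0..1} - a ` {1..k}" and \<nu>: "\<nu> x \<in> {0..1} - a ` {1..k}" if "x \<in> X" for x
    using assms that by (auto simp: fuzzy_subsets_def PiE_iff)
  have cmp: "(a i \<le> \<mu> x \<longleftrightarrow> a i \<le> \<nu> x) \<and> (\<mu> x \<le> a i \<longleftrightarrow> \<nu> x \<le> a i)"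
    if x: "x \<in> X" and i: "i \<le> k + 1" for x i
    using a \<mu>[OF x]
  proof (cases rule: gap_cases)
    case 1
    then show ?thesis using zero[OF x] by simp
  next
    case 2
    then show ?thesis using one[OF x] by simp
  next
    \<comment> \<open>With both points equal to \<open>x\<close>, the gap condition says that
      \<open>\<nu> x\<close> lies in the same gap as \<open>\<mu> x\<close>.\<close>
    case (3 j)
    then show ?thesis
      using gap[of j x x] x i gap_compare[OF a, of j "\<mu> x" i] gap_compare[OF a, of j "\<nu> x" i]
      by simp
  qed
  have le: "\<mu> x \<le> \<mu> y \<longleftrightarrow> \<nu> x \<le> \<nu> y" if x: "x \<in> X" and y: "y \<in> X" for x y
    using a \<mu>[OF x]
  proof (cases rule: gap_cases)
    case 1
    then show ?thesis using zero[OF x] cmp[of y 0] y by simp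
  next
    case 2
    then show ?thesis using one[OF x] cmp[of y "k + 1"] y by simp
  next
    case (3 j)
    then have \<nu>x: "a j < \<nu> x" "\<nu> x < a (j + 1)"
      using gap[of j x x] x by auto
    show ?thesis
    proof (cases "a j < \<mu> y \<and> \<mu> y < a (j + 1)")
      case True
      then have "a j < \<nu> y" "\<nu> y < a (j + 1)"
        using gap[of j y y] y 3 by auto
      then show ?thesis
        using True \<nu>x 3 gap[of j y x] x y by auto
    next
      \<comment> \<open>Here \<open>\<mu> y\<close> is at or beyond an endpoint of the gap of
        \<open>\<mu> x\<close>, and by \<open>cmp\<close> so is \<open>\<nu> y\<close>, on the same
        side.\<close>
      case False
      then show ?thesis
        using 3 \<nu>x cmp[of y j] cmp[of y "j + 1"] y by auto
    qed
  qed
  show "order_type X k (a, \<mu>) = order_type X k (a, \<nu>)"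
    unfolding order_type_eq_iff using cmp le by blast
qed

text \<open>Classes are fibres of the order type, and transport shows that the single choice
  \<open>a\<close> realises all order types. The right side no longer depends on
  \<open>a\<close>.\<close>

lemma card_quotient_eq_card_order_types:
  assumes a: "spikes k a"
  shows "card (fuzzy_subsets X k a // fuzzy_equiv_rel X k a) = card (order_type X k ` spiked_maps X k)"
proof -
  let ?A = "fuzzy_subsets X k a" and ?R = "fuzzy_equiv_rel X k a"
  have "?A // ?R = (\<lambda>\<mu>. ?R `` {\<mu>}) ` ?A"
    by (auto simp: quotient_def)
  moreover have "card ((\<lambda>\<mu>. ?R `` {\<mu>}) ` ?A) = card (order_type X k ` spiked_maps X k)"
  proof (rule card_image_eq_card_image[where h = "\<lambda>\<mu>. (a, \<mu>)"])
    fix \<mu> \<nu> assume "\<mu> \<in> ?A" "\<nu> \<in> ?A"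
    then show "?R `` {\<mu>} = ?R `` {\<nu>} \<longleftrightarrow> order_type X k (a, \<mu>) = order_type X k (a, \<nu>)"
      using eq_equiv_class_iff[OF equiv_fuzzy_equiv_rel, of \<mu> X k a \<nu>]
        fuzzy_equiv_iff_order_type[OF a]
      by (simp add: fuzzy_equiv_rel_def)
  next
    fix \<mu> assume "\<mu> \<in> ?A"
    then show "(a, \<mu>) \<in> spiked_maps X k"
      using a by (auto simp: spiked_maps_def fuzzy_subsets_def PiE_iff)
  next
    fix q assume "q \<in> spiked_maps X k"
    then show "\<exists>\<mu>\<in>?A. order_type X k (a, \<mu>) = order_type X k q"
      using order_type_transport[OF _ a] by (cases q) blast
  qed
  ultimately show ?thesis
    by simp
qed

text \<open>Relabelling points by a bijection leaves all comparisons intact, so only the size of the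
  ground set matters.\<close>

lemma card_order_types_cong:
  assumes "finite X" "finite Y" "card X = card Y"
  shows "card (order_type X k ` spiked_maps X k) = card (order_type Y k ` spiked_maps Y k)"
proof -
  obtain e where e: "bij_betw e Y X"
    using finite_same_card_bij[OF assms(2,1)] assms(3) by auto
  then have eX: "e ` Y = X"
    by (simp add: bij_betw_def)
  show ?thesis
  proof (rule card_image_eq_card_image[where h = "\<lambda>(a, \<mu>). (a, \<mu> \<circ> e)"], goal_cases)
    case (1 p q)
    then show ?case
      by (cases p; cases q) (simp only: split order_type_eq_iff, simp flip: eX)
  next
    case (2 p)
    then show ?case
      by (cases p) (simp add: spiked_maps_def flip: eX)
  next
    case (3 q)
    obtain b \<nu> where q: "q = (b, \<nu>)"
      by (cases q)
    let ?f = "inv_into Y e"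
    have f: "?f (e y) = y" if "y \<in> Y" for y
      using e that by (simp add: bij_betw_def)
    have "(b, \<nu> \<circ> ?f) \<in> spiked_maps X k"
      using 3 f unfolding q by (auto simp: spiked_maps_def simp flip: eX)
    \<comment> \<open>The two functions are known to agree only on \<open>Y\<close>, hence the
      comparison of order types.\<close>
    moreover have "order_type Y k (b, (\<nu> \<circ> ?f) \<circ> e) = order_type Y k (b, \<nu>)"
      unfolding order_type_eq_iff using f by simp
    ultimately show ?case
      unfolding q by (intro bexI[of _ "(b, \<nu> \<circ> ?f)"]) simp_all
  qed
qed


section \<open>The recurrence\<close>

definition maps_at_end :: "'a set \<Rightarrow> nat \<Rightarrow> 'a \<Rightarrow> nat \<Rightarrow> ((nat \<Rightarrow> real) \<times> ('a \<Rightarrow> real)) set" where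
  "maps_at_end X k z i = {(a, \<mu>) \<in> spiked_maps (insert z X) k. \<mu> z = a i}"

text \<open>The set \<open>S\<close> of points tied with \<open>z\<close> is a parameter, so that
  all maps of one piece reduce to the same ground set \<open>X - S\<close>.\<close>

definition maps_in_gap ::
  "'a set \<Rightarrow> nat \<Rightarrow> 'a \<Rightarrow> nat \<Rightarrow> 'a set \<Rightarrow> ((nat \<Rightarrow> real) \<times> ('a \<Rightarrow> real)) set" where
  "maps_in_gap X k z j S =
     {(a, \<mu>) \<in> spiked_maps (insert z X) k. a j < \<mu> z \<and> \<mu> z < a (j + 1) \<and> {x \<in> X. \<mu> x = \<mu> z} = S}"

section \<open>The distinguished point at an end\<close>

text \<open>Comparisons of \<open>z\<close> with other points are their comparisons with entry
  \<open>i\<close>, already recorded on \<open>X\<close>, and those with the spikes are fixed.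
  Forgetting \<open>z\<close> thus loses nothing.\<close>

lemma card_order_types_at_end:
  assumes z: "z \<notin> X" and i: "i \<in> {0, k + 1}"
  shows "card (order_type (insert z X) k ` maps_at_end X k z i) = card (order_type X k ` spiked_maps X k)"
proof (rule card_image_eq_card_image[where h = "\<lambda>p. p"], goal_cases)
  case (1 p q)
  obtain a \<mu> b \<nu> where pq: "p = (a, \<mu>)" "q = (b, \<nu>)"
    by (cases p; cases q)
  have ab: "spikes k a" "spikes k b" "\<mu> z = a i" "\<nu> z = b i" and i': "i \<le> k + 1"
    using 1 i by (auto simp: pq maps_at_end_def spiked_maps_def)
  show ?case
    unfolding pq order_type_eq_iff
    using ab i' by (auto simp: spikes_le_iff[OF ab(1)] spikes_le_iff[OF ab(2)])
next
  case (2 p)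
  then show ?case
    by (auto simp: maps_at_end_def spiked_maps_def)
next
  case (3 q)
  obtain b \<nu> where q: "q = (b, \<nu>)"
    by (cases q)
  have b: "spikes k b"
    using 3 by (auto simp: q spiked_maps_def)
  \<comment> \<open>An end value is not a spike, so \<open>z\<close> may be placed there.\<close>
  have "b i \<noteq> b j" if "j \<in> {1..k}" for j
    using spikes_le_iff[OF b, of i j] spikes_le_iff[OF b, of j i] i that by auto
  then have "b i \<notin> b ` {1..k}"
    by blast
  moreover have "b i \<in> {0..1}"
    using b i by (auto simp: spikes_def)
  ultimately have "(b, \<nu>(z := b i)) \<in> maps_at_end X k z i"
    using 3 z by (auto simp: q maps_at_end_def spiked_maps_def)
  moreover have "order_type X k (b, \<nu>(z := b i)) = order_type X k (b, \<nu>)"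
    unfolding order_type_eq_iff using z by auto
  ultimately show ?case
    unfolding q by blast
qed

section \<open>The distinguished point inside a gap\<close>

text \<open>For \<open>c\<close> in gap \<open>j\<close> the sequence stays sorted, and the final
  \<open>1\<close> moves to index \<open>k + 2\<close>, as \<open>spikes (k + 1)\<close>
  requires.\<close>

definition add_spike :: "nat \<Rightarrow> real \<Rightarrow> (nat \<Rightarrow> real) \<Rightarrow> nat \<Rightarrow> real" where
  "add_spike j c a i = (if i \<le> j then a i else if i = j + 1 then c else a (i - 1))"

lemma spikes_add_spike:
  assumes "spikes k a" "j \<le> k" "a j < c" "c < a (j + 1)"
  shows "spikes (k + 1) (add_spike j c a)"
  unfolding spikes_def
proof (intro conjI allI impI)
  fix i assume i: "i \<le> k + 1"
  consider "i < j" | "i = j" | "i = j + 1" | m where "i = Suc m" "j < m"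
    by (metis Suc_eq_plus1 linorder_neqE_nat not_less_eq old.nat.exhaust less_nat_zero_code)
  then show "add_spike j c a i < add_spike j c a (i + 1)"
    using assms i by cases (auto simp: add_spike_def spikes_def)
qed (use assms in \<open>auto simp: add_spike_def spikes_def\<close>)

text \<open>Comparing a point with \<open>z\<close> is comparing it with the new spike. Points of
  \<open>S\<close> share the value of \<open>z\<close>, so their comparisons can be restored from
  the rest.\<close>

lemma order_type_add_spike:
  assumes ab: "spikes k a" "spikes k b" and j: "j \<le> k"
    and c: "a j < c" "c < a (j + 1)" and d: "b j < d" "d < b (j + 1)"
    and S: "\<And>x. x \<in> X \<Longrightarrow> \<mu> x = c \<longleftrightarrow> x \<in> S" "\<And>x. x \<in> X \<Longrightarrow> \<nu> x = d \<longleftrightarrow> x \<in> S"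
    and z: "\<mu> z = c" "\<nu> z = d"
  shows "order_type (insert z X) k (a, \<mu>) = order_type (insert z X) k (b, \<nu>) \<longleftrightarrow>
    order_type (X - S) (k + 1) (add_spike j c a, \<mu>) = order_type (X - S) (k + 1) (add_spike j d b, \<nu>)"
    (is "?L \<longleftrightarrow> ?R")
proof
  assume ?L
  then have cmp: "\<And>x i. x \<in> insert z X \<Longrightarrow> i \<le> k + 1 \<Longrightarrow>
      (a i \<le> \<mu> x \<longleftrightarrow> b i \<le> \<nu> x) \<and> (\<mu> x \<le> a i \<longleftrightarrow> \<nu> x \<le> b i)"
    and le: "\<And>x y. x \<in> insert z X \<Longrightarrow> y \<in> insert z X \<Longrightarrow> \<mu> x \<le> \<mu> y \<longleftrightarrow> \<nu> x \<le> \<nu> y"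
    unfolding order_type_eq_iff by blast+
  \<comment> \<open>Indices up to \<open>j\<close> are old, index \<open>j + 1\<close> is a
    comparison with \<open>z\<close>, and later ones come from the old index
    \<open>i - 1\<close>.\<close>
  have "(add_spike j c a i \<le> \<mu> x \<longleftrightarrow> add_spike j d b i \<le> \<nu> x) \<and>
      (\<mu> x \<le> add_spike j c a i \<longleftrightarrow> \<nu> x \<le> add_spike j d b i)"
    if "x \<in> X - S" "i \<le> k + 2" for x i
    using cmp[of x i] cmp[of x "i - 1"] le[of x z] le[of z x] that j z
    by (auto simp: add_spike_def)
  then show ?R
    unfolding order_type_eq_iff using le by simp
next
  assume ?R
  then have cmp: "\<And>x i. x \<in> X - S \<Longrightarrow> i \<le> k + 2 \<Longrightarrow>
      (add_spike j c a i \<le> \<mu> x \<longleftrightarrow> add_spike j d b i \<le> \<nu> x) \<and>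
      (\<mu> x \<le> add_spike j c a i \<longleftrightarrow> \<nu> x \<le> add_spike j d b i)"
    and le: "\<And>x y. x \<in> X - S \<Longrightarrow> y \<in> X - S \<Longrightarrow> \<mu> x \<le> \<mu> y \<longleftrightarrow> \<nu> x \<le> \<nu> y"
    unfolding order_type_eq_iff by auto
  have S': "\<mu> x = c \<and> \<nu> x = d" if "x \<in> insert z X" "x \<notin> X - S" for x
    using that S z by auto
  \<comment> \<open>Entry \<open>j + 1\<close> is the new spike; reading it off recovers all
    comparisons with \<open>z\<close>.\<close>
  have c_cmp: "(c \<le> \<mu> x \<longleftrightarrow> d \<le> \<nu> x) \<and> (\<mu> x \<le> c \<longleftrightarrow> \<nu> x \<le> d)" if "x \<in> insert z X" for x
    using cmp[of x "j + 1"] S'[OF that] j by (cases "x \<in> X - S") (auto simp: add_spike_def)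
  have "(a i \<le> \<mu> x \<longleftrightarrow> b i \<le> \<nu> x) \<and> (\<mu> x \<le> a i \<longleftrightarrow> \<nu> x \<le> b i)"
    if x: "x \<in> insert z X" and i: "i \<le> k + 1" for x i
  proof (cases "x \<in> X - S")
    case True
    then show ?thesis
      using cmp[of x i] cmp[of x "i + 1"] i by (cases "i \<le> j") (auto simp: add_spike_def)
  next
    \<comment> \<open>The point has value \<open>c\<close> under \<open>\<mu>\<close> and
      \<open>d\<close> under \<open>\<nu>\<close>, both in gap \<open>j\<close>, which fixes all
      comparisons with the spikes.\<close>
    case False
    then show ?thesis
      using S'[OF x] gap_compare[OF ab(1) j c i] gap_compare[OF ab(2) j d i] by simp
  qed
  moreover have "\<mu> x \<le> \<mu> y \<longleftrightarrow> \<nu> x \<le> \<nu> y" if "x \<in> insert z X" "y \<in> insert z X" for x y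
    using le[of x y] S'[OF that(1)] S'[OF that(2)] c_cmp[OF that(1)] c_cmp[OF that(2)]
    by (cases "x \<in> X - S"; cases "y \<in> X - S") auto
  ultimately show ?L
    unfolding order_type_eq_iff by blast
qed

text \<open>Once \<open>\<mu> z\<close> is a spike, the points off \<open>S\<close> avoid it exactly
  because they are not tied with \<open>z\<close>. Conversely, spike \<open>j + 1\<close> can be
  deleted and its value given to \<open>z\<close> and \<open>S\<close>.\<close>

lemma card_order_types_in_gap:
  assumes z: "z \<notin> X" and j: "j \<le> k" and S: "S \<subseteq> X"
  shows "card (order_type (insert z X) k ` maps_in_gap X k z j S) =
    card (order_type (X - S) (k + 1) ` spiked_maps (X - S) (k + 1))"
proof (rule card_image_eq_card_image[where h = "\<lambda>(a, \<mu>). (add_spike j (\<mu> z) a, \<mu>)"], goal_cases)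
  case (1 p q)
  obtain a \<mu> b \<nu> where pq: "p = (a, \<mu>)" "q = (b, \<nu>)"
    by (cases p; cases q)
  show ?case
    unfolding pq split
    by (rule order_type_add_spike) (use 1 j in \<open>auto simp: pq maps_in_gap_def spiked_maps_def\<close>)
next
  case (2 p)
  obtain a \<mu> where p: "p = (a, \<mu>)"
    by (cases p)
  have a: "spikes k a" "a j < \<mu> z" "\<mu> z < a (j + 1)" and S': "S = {x \<in> X. \<mu> x = \<mu> z}"
    and \<mu>: "\<And>x. x \<in> X \<Longrightarrow> \<mu> x \<in> {0..1} - a ` {1..k}"
    using 2 by (auto simp: p maps_in_gap_def spiked_maps_def)
  have "\<mu> x \<noteq> add_spike j (\<mu> z) a i" if "x \<in> X - S" "i \<in> {1..k + 1}" for x i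
  proof -
    have *: "\<mu> x \<noteq> a m" if "m \<in> {1..k}" for m
      using \<mu>[of x] \<open>x \<in> X - S\<close> that by blast
    consider "i \<le> j" | "i = j + 1" | "j + 1 < i"
      by linarith
    then show ?thesis
    proof cases
      case 1
      then show ?thesis using *[of i] that j by (simp add: add_spike_def)
    next
      case 2
      then show ?thesis using that S' by (simp add: add_spike_def)
    next
      case 3
      then have "i - 1 \<in> {1..k}" using that by auto
      from *[OF this] show ?thesis using 3 by (simp add: add_spike_def)
    qed
  qed
  then show ?case
    using spikes_add_spike[OF a(1) j a(2,3)] \<mu> by (auto simp: p spiked_maps_def)
next
  case (3 q)
  obtain b \<nu> where q: "q = (b, \<nu>)"
    by (cases q)
  have b: "spikes (k + 1) b" and \<nu>: "\<And>x. x \<in> X - S \<Longrightarrow> \<nu> x \<in> {0..1} - b ` {1..k + 1}"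
    using 3 by (auto simp: q spiked_maps_def)
  \<comment> \<open>The inverse construction: \<open>a\<close> skips entry \<open>j + 1\<close> of
    \<open>b\<close>, and \<open>\<mu>\<close> takes that entry as its value on \<open>z\<close> and
    \<open>S\<close>.\<close>
  define a where "a i = (if i \<le> j then b i else b (i + 1))" for i
  define \<mu> where "\<mu> x = (if x \<in> insert z S then b (j + 1) else \<nu> x)" for x
  have a: "spikes k a"
    unfolding spikes_def
  proof (intro conjI allI impI)
    fix i assume i: "i \<le> k"
    show "a i < a (i + 1)"
      using spikes_less[OF b, of i "i + 1"] spikes_less[OF b, of i "i + 2"]
        spikes_less[OF b, of "i + 1" "i + 2"] i
      by (auto simp: a_def)
  qed (use b j in \<open>auto simp: a_def spikes_def\<close>)
  have "b (j + 1) \<noteq> a i" if "i \<in> {1..k}" for i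
    using that j spikes_less[OF b, of i "j + 1"] spikes_less[OF b, of "j + 1" "i + 1"]
    by (cases "i \<le> j") (simp_all add: a_def)
  moreover have "b (j + 1) \<in> {0..1}"
    using spikes_less[OF b, of 0 "j + 1"] spikes_less[OF b, of "j + 1" "k + 2"] b j
    by (auto simp: spikes_def)
  ultimately have new: "b (j + 1) \<in> {0..1} - a ` {1..k}"
    by blast
  have old: "\<nu> x \<in> {0..1} - a ` {1..k}" if "x \<in> X - S" for x
    using \<nu>[OF that] by (auto simp: a_def split: if_splits)
  \<comment> \<open>Avoiding the deleted spike ensures that no point outside \<open>S\<close>
    becomes tied with \<open>z\<close>.\<close>
  have ne: "\<nu> x \<noteq> b (j + 1)" if "x \<in> X - S" for x
    using \<nu>[OF that] j by auto
  have "a j < b (j + 1)" "b (j + 1) < a (j + 1)"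
    using spikes_less[OF b, of j "j + 1"] spikes_less[OF b, of "j + 1" "j + 2"] j
    by (auto simp: a_def)
  moreover have "{x \<in> X. \<mu> x = \<mu> z} = S"
    using S z ne by (auto simp: \<mu>_def)
  ultimately have "(a, \<mu>) \<in> maps_in_gap X k z j S"
    using a new old by (auto simp: maps_in_gap_def spiked_maps_def \<mu>_def)
  moreover have "add_spike j (\<mu> z) a = b"
    by (auto simp: fun_eq_iff add_spike_def a_def \<mu>_def)
  moreover have "order_type (X - S) (k + 1) (b, \<mu>) = order_type (X - S) (k + 1) (b, \<nu>)"
    unfolding order_type_eq_iff using z by (auto simp: \<mu>_def)
  ultimately show ?case
    unfolding q by (intro bexI[of _ "(a, \<mu>)"]) simp_all
qed

section \<open>Decomposition and assembly\<close>

lemma spiked_maps_insert: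
  "spiked_maps (insert z X) k = maps_at_end X k z 0 \<union> maps_at_end X k z (k + 1) \<union>
     (\<Union>(j, S)\<in>{..k} \<times> Pow X. maps_in_gap X k z j S)"
proof (intro equalityI subsetI)
  fix p assume p: "p \<in> spiked_maps (insert z X) k"
  obtain a \<mu> where p': "p = (a, \<mu>)"
    by (cases p)
  have a: "spikes k a" and \<mu>: "\<mu> z \<in> {0..1} - a ` {1..k}"
    using p by (auto simp: p' spiked_maps_def)
  from a \<mu> show "p \<in> maps_at_end X k z 0 \<union> maps_at_end X k z (k + 1) \<union>
     (\<Union>(j, S)\<in>{..k} \<times> Pow X. maps_in_gap X k z j S)"
  proof (cases rule: gap_cases)
    case (3 j)
    then have "p \<in> maps_in_gap X k z j {x \<in> X. \<mu> x = \<mu> z}"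
      using p by (auto simp: p' maps_in_gap_def)
    then show ?thesis
      using 3 by (intro UnI2 UN_I[of "(j, {x \<in> X. \<mu> x = \<mu> z})"]) auto
  qed (use p in \<open>auto simp: p' maps_at_end_def\<close>)
qed (auto simp: maps_at_end_def maps_in_gap_def)

text \<open>Equality with entry \<open>i\<close> amounts to two recorded comparisons, so the order
  type reveals it. This makes images of pieces disjoint, not merely the pieces.\<close>

lemma order_type_at_end_unique:
  assumes "(a, \<mu>) \<in> maps_at_end X k z i" "(b, \<nu>) \<in> spiked_maps (insert z X) k" "i \<le> k + 1"
    and "order_type (insert z X) k (a, \<mu>) = order_type (insert z X) k (b, \<nu>)"
  shows "(b, \<nu>) \<in> maps_at_end X k z i"
proof -
  have "\<mu> z = a i"
    using assms by (simp add: maps_at_end_def)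
  then have "\<nu> z = b i"
    using assms(3,4) unfolding order_type_eq_iff by (metis insertI1 order_antisym order_refl)
  then show ?thesis
    using assms(2) by (simp add: maps_at_end_def)
qed

text \<open>The entries at or below \<open>\<mu> z\<close> are those with index up to
  \<open>j\<close>, so the order type determines \<open>j\<close>; ties with \<open>z\<close>, being
  two-sided comparisons, determine \<open>S\<close>.\<close>

lemma order_type_in_gap_unique:
  assumes p: "(a, \<mu>) \<in> maps_in_gap X k z j S" and q: "(b, \<nu>) \<in> maps_in_gap X k z j' S'"
    and j: "j \<le> k" "j' \<le> k"
    and eq: "order_type (insert z X) k (a, \<mu>) = order_type (insert z X) k (b, \<nu>)"
  shows "j = j' \<and> S = S'"
proof -
  have a: "spikes k a" "a j < \<mu> z" "\<mu> z < a (j + 1)" "S = {x \<in> X. \<mu> x = \<mu> z}"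
    and b: "spikes k b" "b j' < \<nu> z" "\<nu> z < b (j' + 1)" "S' = {x \<in> X. \<nu> x = \<nu> z}"
    using p q by (auto simp: maps_in_gap_def spiked_maps_def)
  have cmp: "\<And>i. i \<le> k + 1 \<Longrightarrow> a i \<le> \<mu> z \<longleftrightarrow> b i \<le> \<nu> z"
    and le: "\<And>x y. x \<in> insert z X \<Longrightarrow> y \<in> insert z X \<Longrightarrow> \<mu> x \<le> \<mu> y \<longleftrightarrow> \<nu> x \<le> \<nu> y"
    using eq unfolding order_type_eq_iff by blast+
  have "i \<le> j \<longleftrightarrow> i \<le> j'" if "i \<le> k + 1" for i
    using cmp[OF that] gap_compare(1)[OF a(1) j(1) a(2,3) that]
      gap_compare(1)[OF b(1) j(2) b(2,3) that] by simp
  from this[of j] this[of j'] have "j = j'"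
    using j by simp
  moreover have "\<mu> x = \<mu> z \<longleftrightarrow> \<nu> x = \<nu> z" if "x \<in> X" for x
    using le[of x z] le[of z x] that by auto
  ultimately show ?thesis
    using a(4) b(4) by blast
qed

lemma order_types_disjointI:
  assumes "\<And>a \<mu> b \<nu>. (a, \<mu>) \<in> A \<Longrightarrow> (b, \<nu>) \<in> B \<Longrightarrow> order_type X k (a, \<mu>) \<noteq> order_type X k (b, \<nu>)"
  shows "order_type X k ` A \<inter> order_type X k ` B = {}"
proof -
  have "order_type X k p \<noteq> order_type X k q" if "p \<in> A" "q \<in> B" for p q
    using assms[of "fst p" "snd p" "fst q" "snd q"] that by simp
  then show ?thesis
    by blast
qed

text \<open>The pieces have pairwise disjoint images. The two ends contribute equally, giving the
  factor \<open>2\<close>.\<close>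

lemma card_order_types_insert:
  assumes X: "finite X" and z: "z \<notin> X"
  shows "card (order_type (insert z X) k ` spiked_maps (insert z X) k) =
    2 * card (order_type X k ` spiked_maps X k) +
    (k + 1) * (\<Sum>S\<in>Pow X. card (order_type (X - S) (k + 1) ` spiked_maps (X - S) (k + 1)))"
proof -
  let ?T = "order_type (insert z X) k"
  let ?E0 = "?T ` maps_at_end X k z 0" and ?E1 = "?T ` maps_at_end X k z (k + 1)"
  let ?G = "\<lambda>(j, S). ?T ` maps_in_gap X k z j S"
  let ?I = "{..k} \<times> Pow X"
  have fin: "finite (?T ` A)" for A
    using X by (simp add: finite_order_type_image)
  have end_not_end: "\<not> (p \<in> maps_at_end X k z 0 \<and> p \<in> maps_at_end X k z (k + 1))" for p
    by (auto simp: maps_at_end_def spiked_maps_def spikes_def)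
  have gap_not_end: "\<not> (p \<in> maps_in_gap X k z j S \<and> p \<in> maps_at_end X k z i)"
    if "j \<le> k" "i \<le> k + 1" for p i j S
    using that gap_compare[of k "fst p" j "snd p z" i]
    by (auto simp: maps_at_end_def maps_in_gap_def spiked_maps_def)
  have sub: "maps_at_end X k z i \<subseteq> spiked_maps (insert z X) k"
    "maps_in_gap X k z j S \<subseteq> spiked_maps (insert z X) k" for i j S
    by (auto simp: maps_at_end_def maps_in_gap_def)
  have E: "?E0 \<inter> ?E1 = {}"
  proof (rule order_types_disjointI, rule notI)
    fix a \<mu> b \<nu>
    assume *: "(a, \<mu>) \<in> maps_at_end X k z 0" "(b, \<nu>) \<in> maps_at_end X k z (k + 1)"
      "?T (a, \<mu>) = ?T (b, \<nu>)"
    show False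
      using order_type_at_end_unique[OF *(1) _ _ *(3)] *(2) sub(1) end_not_end by blast
  qed
  have EG: "?T ` maps_at_end X k z i \<inter> ?T ` maps_in_gap X k z j S = {}"
    if "j \<le> k" "i \<le> k + 1" for i j S
  proof (rule order_types_disjointI, rule notI)
    fix a \<mu> b \<nu>
    assume *: "(a, \<mu>) \<in> maps_at_end X k z i" "(b, \<nu>) \<in> maps_in_gap X k z j S"
      "?T (a, \<mu>) = ?T (b, \<nu>)"
    show False
      using order_type_at_end_unique[OF *(1) _ that(2) *(3)] *(2) sub(2) gap_not_end[OF that] by blast
  qed
  have G: "?T ` maps_in_gap X k z j S \<inter> ?T ` maps_in_gap X k z j' S' = {}"
    if "j \<le> k" "j' \<le> k" "(j, S) \<noteq> (j', S')" for j S j' S'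
  proof (rule order_types_disjointI, rule notI)
    fix a \<mu> b \<nu>
    assume "(a, \<mu>) \<in> maps_in_gap X k z j S" "(b, \<nu>) \<in> maps_in_gap X k z j' S'"
      "?T (a, \<mu>) = ?T (b, \<nu>)"
    then show False
      using order_type_in_gap_unique that by (metis (no_types))
  qed
  have "?T ` spiked_maps (insert z X) k = ?E0 \<union> ?E1 \<union> (\<Union>i\<in>?I. ?G i)"
    unfolding spiked_maps_insert by (simp only: image_Un image_UN split_def)
  also have "card \<dots> = card (?E0 \<union> ?E1) + card (\<Union>i\<in>?I. ?G i)"
  proof (rule card_Un_disjoint)
    show "finite (\<Union>i\<in>?I. ?G i)"
      using X fin by (intro finite_UN_I) auto
    have "(?E0 \<union> ?E1) \<inter> ?G i = {}" if "i \<in> ?I" for i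
      using that EG[of "fst i" 0 "snd i"] EG[of "fst i" "k + 1" "snd i"]
      by (simp add: split_def Int_Un_distrib2 mem_Times_iff)
    then show "(?E0 \<union> ?E1) \<inter> (\<Union>i\<in>?I. ?G i) = {}"
      by blast
  qed (use fin in simp)
  also have "card (?E0 \<union> ?E1) = card ?E0 + card ?E1"
    by (rule card_Un_disjoint[OF fin fin E])
  also have "card (\<Union>i\<in>?I. ?G i) = (\<Sum>i\<in>?I. card (?G i))"
    by (rule card_UN_disjoint) (use X fin G in auto)
  also have "\<dots> = (\<Sum>(j, S)\<in>?I. card (order_type (X - S) (k + 1) ` spiked_maps (X - S) (k + 1)))"
    by (intro sum.cong refl) (use card_order_types_in_gap[OF z] in auto)
  \<comment> \<open>The summand does not depend on the gap \<open>j\<close>, whence the factor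
    \<open>k + 1\<close>.\<close>
  also have "\<dots> = (k + 1) *
      (\<Sum>S\<in>Pow X. card (order_type (X - S) (k + 1) ` spiked_maps (X - S) (k + 1)))"
    by (simp flip: sum.cartesian_product)
  finally show ?thesis
    by (simp add: card_order_types_at_end[OF z])
qed

theorem theorem3p2:
  fixes X :: "nat \<Rightarrow> 'a set" and a :: "nat \<Rightarrow> nat \<Rightarrow> real" and n k :: nat
  assumes X: "\<And>m. finite (X m) \<and> card (X m) = m"
    and a: "\<And>l. spikes l (a l)"
  shows "F2 X a (n + 1) k =
    2 * F2 X a n k + (k + 1) * (\<Sum>i=0..n. (n choose i) * F2 X a (n - i) (k + 1))"
proof -
  \<comment> \<open>Arbitrary finite sets are needed because \<open>Y - S\<close> need not belong to
    the family \<open>X\<close>.\<close>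
  have F2: "F2 X a (card Y) l = card (order_type Y l ` spiked_maps Y l)" if "finite Y" for Y l
    unfolding F2_def card_quotient_eq_card_order_types[OF a]
    by (rule card_order_types_cong) (use X that in auto)
  obtain z Y where zY: "X (n + 1) = insert z Y" "z \<notin> Y" "card Y = n" "finite Y"
    using X[of "n + 1"] by (metis Suc_eq_plus1 card_Suc_eq finite_insert)
  have "F2 X a (n + 1) k = 2 * F2 X a n k +
      (k + 1) * (\<Sum>S\<in>Pow Y. card (order_type (Y - S) (k + 1) ` spiked_maps (Y - S) (k + 1)))"
    using F2[of "insert z Y" k] F2[of Y k] card_order_types_insert[OF zY(4,2)] zY by simp
  also have "(\<Sum>S\<in>Pow Y. card (order_type (Y - S) (k + 1) ` spiked_maps (Y - S) (k + 1))) =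
      (\<Sum>S\<in>Pow Y. F2 X a (n - card S) (k + 1))"
    using zY by (intro sum.cong refl) (auto simp: card_Diff_subset finite_subset simp flip: F2)
  \<comment> \<open>Grouping the tied sets \<open>S\<close> by size produces the binomial
    coefficients.\<close>
  also have "\<dots> = (\<Sum>i=0..n. (n choose i) * F2 X a (n - i) (k + 1))"
    using sum_Pow_card[OF zY(4), of "\<lambda>i. F2 X a (n - i) (k + 1)"] zY(3) by simp
  finally show ?thesis .
qed

end
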